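(* There exist a precompact TAP group $G$ and a countably compact $G^\star$-regular space $X$ such that $C_p(X,G)$ is not TAP.
   Context: All spaces are Tychonoff and non-empty; topological groups are Hausdorff; $e$ denotes the identity. A topological group is precompact if it is a subgroup of some compact group. $C_p(X,G)$ is the group of all continuous maps $X\to G$ with pointwise operations and the topology of pointwise convergence. $X$ is $G^\star$-regular if there exists $g\in G\setminus\{e\}$ such that for every closed $F\subseteq X$ and every $x\in X\setminus F$ there is $f\in C_p(X,G)$ with $f(x)=g$ and $f(F)\subseteq\{e\}$. A subset $A$ of a topological group $H$ is absolutely productive in $H$ if for every injection $a:\mathbb{N}\to A$ and every map $z:\mathbb{N}\to\mathbb{Z}$ the sequence $\left(\prod_{n=0}^{k}a(n)^{z(n)}\right)_{k\in\mathbb{N}}$ converges in $H$; $H$ is TAP if every absolutely productive subset of $H$ is finite. *)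

theory Defs
  imports "HOL-Analysis.Analysis" "HOL-Algebra.Algebra"
begin

definition topological_group :: "'a monoid \<Rightarrow> 'a topology \<Rightarrow> bool" where
  "topological_group G T \<longleftrightarrow>
     group G \<and> topspace T = carrier G \<and> Hausdorff_space T \<and>
     continuous_map (prod_topology T T) T (\<lambda>p. fst p \<otimes>\<^bsub>G\<^esub> snd p) \<and>
     continuous_map T T (\<lambda>x. inv\<^bsub>G\<^esub> x)"

text \<open>Precompact: (topologically isomorphic to) a subgroup of some compact group.
The compact group is taken on carrier type 'a set set, which is large enough to hold
e.g. the Weil completion of G.\<close>
definition precompact_group :: "'a monoid \<Rightarrow> 'a topology \<Rightarrow> bool" where
  "precompact_group G T \<longleftrightarrow> topological_group G T \<and>
     (\<exists>(K :: 'a set set monoid) TK f. topological_group K TK \<and> compact_space TK \<and>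
        f \<in> hom G K \<and> inj_on f (carrier G) \<and> embedding_map T TK f)"

fun partial_prod :: "'a monoid \<Rightarrow> (nat \<Rightarrow> 'a) \<Rightarrow> (nat \<Rightarrow> int) \<Rightarrow> nat \<Rightarrow> 'a" where
  "partial_prod H a z 0 = a 0 [^]\<^bsub>H\<^esub> z 0"
| "partial_prod H a z (Suc k) = partial_prod H a z k \<otimes>\<^bsub>H\<^esub> (a (Suc k) [^]\<^bsub>H\<^esub> z (Suc k))"

definition absolutely_productive :: "'a monoid \<Rightarrow> 'a topology \<Rightarrow> 'a set \<Rightarrow> bool" where
  "absolutely_productive H T A \<longleftrightarrow> A \<subseteq> carrier H \<and>
     (\<forall>a z. inj a \<and> range a \<subseteq> A \<longrightarrow>
        (\<exists>l. limitin T (partial_prod H a z) l sequentially))"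

definition TAP :: "'a monoid \<Rightarrow> 'a topology \<Rightarrow> bool" where
  "TAP H T \<longleftrightarrow> (\<forall>A. absolutely_productive H T A \<longrightarrow> finite A)"

definition tychonoff_space :: "'a topology \<Rightarrow> bool" where
  "tychonoff_space S \<longleftrightarrow> completely_regular_space S \<and> Hausdorff_space S"

definition countably_compact_space :: "'a topology \<Rightarrow> bool" where
  "countably_compact_space S \<longleftrightarrow>
     (\<forall>\<U>. countable \<U> \<and> (\<forall>U\<in>\<U>. openin S U) \<and> topspace S \<subseteq> \<Union>\<U> \<longrightarrow>
        (\<exists>\<F>. finite \<F> \<and> \<F> \<subseteq> \<U> \<and> topspace S \<subseteq> \<Union>\<F>))"

text \<open>C_p(S,G): continuous maps S \<rightarrow> G (represented as extensional functions on
topspace S, value undefined outside), pointwise operations, and the topology of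
pointwise convergence (subspace of the product topology).\<close>
definition Cp_group :: "'x topology \<Rightarrow> 'a monoid \<Rightarrow> 'a topology \<Rightarrow> ('x \<Rightarrow> 'a) monoid" where
  "Cp_group S G T =
     \<lparr> carrier = {f \<in> topspace (product_topology (\<lambda>_. T) (topspace S)). continuous_map S T f},
       mult = (\<lambda>f g. restrict (\<lambda>x. f x \<otimes>\<^bsub>G\<^esub> g x) (topspace S)),
       one = restrict (\<lambda>x. \<one>\<^bsub>G\<^esub>) (topspace S) \<rparr>"

definition Cp_topology :: "'x topology \<Rightarrow> 'a monoid \<Rightarrow> 'a topology \<Rightarrow> ('x \<Rightarrow> 'a) topology" where
  "Cp_topology S G T =
     subtopology (product_topology (\<lambda>_. T) (topspace S)) (carrier (Cp_group S G T))"

definition G_star_regular :: "'x topology \<Rightarrow> 'a monoid \<Rightarrow> 'a topology \<Rightarrow> bool" where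
  "G_star_regular S G T \<longleftrightarrow>
     (\<exists>g \<in> carrier G. g \<noteq> \<one>\<^bsub>G\<^esub> \<and>
       (\<forall>F x. closedin S F \<and> x \<in> topspace S - F \<longrightarrow>
          (\<exists>f \<in> carrier (Cp_group S G T). f x = g \<and> f ` F \<subseteq> {\<one>\<^bsub>G\<^esub>})))"

end

theory Submission
  imports Defs
begin

text \<open>Let \<open>G\<close> be the group of finite subsets of an infinite set under symmetric difference,
topologised as a subgroup of the Cantor cube. An infinite absolutely productive subset of \<open>G\<close>
would contain a sequence of nonempty pairwise disjoint sets, whose product is an infinite set and
hence lies outside \<open>G\<close>. Let \<open>X \<subseteq> G\<close> consist of the sets with at most one element: it is closed in
the cube, hence compact. The maps \<open>x \<mapsto> x \<inter> {i}\<close> from \<open>X\<close> to \<open>G\<close> form an infinite absolutely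
productive set, because any product of them is \<open>x \<mapsto> x \<inter> J\<close> for some \<open>J\<close>.\<close>

section \<open>The Cantor cube of all subsets of a type\<close>

text \<open>Pulling the product topology back along the characteristic predicate makes sets
  themselves the points of the cube, so that the group operation can be the plain symmetric
  difference.\<close>

definition powerset_topology :: "'a set topology" where
  "powerset_topology =
     pullback_topology UNIV (\<lambda>A x. x \<in> A) (product_topology (\<lambda>_. discrete_topology UNIV) UNIV)"

lemma topspace_powerset_topology [simp]: "topspace powerset_topology = UNIV"
  by (simp add: powerset_topology_def topspace_pullback_topology)

lemma homeomorphic_maps_powerset_topology:
  "homeomorphic_maps powerset_topology (product_topology (\<lambda>_. discrete_topology UNIV) UNIV)
     (\<lambda>A x. x \<in> A) Collect"
proof -
  let ?P = "product_topology (\<lambda>_. discrete_topology UNIV) UNIV :: ('a \<Rightarrow> bool) topology"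
  have "continuous_map powerset_topology ?P (id \<circ> (\<lambda>A x. x \<in> A))"
    unfolding powerset_topology_def by (rule continuous_map_pullback) simp
  moreover have "continuous_map ?P powerset_topology Collect"
    unfolding powerset_topology_def by (rule continuous_map_pullback') (auto simp: comp_def)
  ultimately show ?thesis
    by (simp add: homeomorphic_maps_def comp_def)
qed

text \<open>Continuity into a product is checked coordinatewise, and each coordinate takes values in
  the discrete two-point space, where the two fibres decide.\<close>

lemma continuous_map_powerset_topology:
  "continuous_map T powerset_topology f \<longleftrightarrow>
     (\<forall>x. openin T {t \<in> topspace T. x \<in> f t} \<and> openin T {t \<in> topspace T. x \<notin> f t})"
proof -
  have "continuous_map T powerset_topology f \<longleftrightarrow>
      continuous_map T (product_topology (\<lambda>_. discrete_topology UNIV) UNIV) (\<lambda>t x. x \<in> f t)"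
    using homeomorphic_maps_powerset_topology
      continuous_map_compose[of T powerset_topology f _ "\<lambda>A x. x \<in> A"]
      continuous_map_compose[of T _ "\<lambda>t x. x \<in> f t" powerset_topology Collect]
    by (auto simp: homeomorphic_maps_def comp_def)
  also have "\<dots> \<longleftrightarrow> (\<forall>x. continuous_map T (discrete_topology UNIV) (\<lambda>t. x \<in> f t))"
    by (simp add: continuous_map_componentwise_UNIV)
  also have "\<dots> \<longleftrightarrow> (\<forall>x V. openin T {t \<in> topspace T. (x \<in> f t) \<in> V})"
    by (simp add: continuous_map_def)
  also have "\<dots> \<longleftrightarrow>
      (\<forall>x. openin T {t \<in> topspace T. x \<in> f t} \<and> openin T {t \<in> topspace T. x \<notin> f t})"
  proof (intro iffI allI)
    fix x V
    assume *: "\<forall>x. openin T {t \<in> topspace T. x \<in> f t} \<and> openin T {t \<in> topspace T. x \<notin> f t}"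
    have "V \<in> Pow {False, True}"
      by (simp flip: UNIV_bool)
    \<comment> \<open>Only four sets of truth values exist: two with trivial preimage and the two
      singletons covered by \<open>*\<close>.\<close>
    then have "V \<in> {{}, {True}, {False}, UNIV}"
      by (simp add: Pow_insert UNIV_bool) blast
    then show "openin T {t \<in> topspace T. (x \<in> f t) \<in> V}"
      using * by auto
  next
    fix x
    assume *: "\<forall>x V. openin T {t \<in> topspace T. (x \<in> f t) \<in> V}"
    show "openin T {t \<in> topspace T. x \<in> f t} \<and> openin T {t \<in> topspace T. x \<notin> f t}"
      using *[rule_format, of x "{True}"] *[rule_format, of x "{False}"] by simp
  qed
  finally show ?thesis .
qed

text \<open>Convergence in the cube is coordinatewise, and in a discrete space a convergent net is
  eventually equal to its limit.\<close>

lemma limitin_powerset_topology: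
  fixes f :: "'b \<Rightarrow> 'a set"
  shows
  "limitin powerset_topology f l F \<longleftrightarrow> (\<forall>x. \<forall>\<^sub>F t in F. x \<in> f t \<longleftrightarrow> x \<in> l)"
proof -
  have "limitin powerset_topology f l F \<longleftrightarrow>
      limitin (product_topology (\<lambda>_. discrete_topology UNIV) UNIV) (\<lambda>t x. x \<in> f t) (\<lambda>x. x \<in> l) F"
    using homeomorphic_maps_powerset_topology
      continuous_map_limit[of powerset_topology _ "\<lambda>A x. x \<in> A" f l F]
      continuous_map_limit[of _ powerset_topology Collect "\<lambda>t x. x \<in> f t" "\<lambda>x. x \<in> l" F]
    by (auto simp: homeomorphic_maps_def comp_def)
  also have "\<dots> \<longleftrightarrow> (\<forall>x. \<forall>\<^sub>F t in F. x \<in> f t \<longleftrightarrow> x \<in> l)"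
  proof -
    have "limitin (discrete_topology UNIV) p b F \<longleftrightarrow> (\<forall>\<^sub>F t in F. p t = b)" for p :: "'b \<Rightarrow> bool" and b
    proof
      assume "limitin (discrete_topology UNIV) p b F"
      then have "\<forall>\<^sub>F t in F. p t \<in> {b}"
        unfolding limitin_def by (metis openin_discrete_topology singletonI subset_UNIV)
      then show "\<forall>\<^sub>F t in F. p t = b"
        by simp
    next
      assume "\<forall>\<^sub>F t in F. p t = b"
      then show "limitin (discrete_topology UNIV) p b F"
        by (rule limitin_eventually[rotated]) simp
    qed
    then show ?thesis
      by (simp add: limitin_componentwise)
  qed
  finally show ?thesis .
qed

lemma openin_powerset_topology_coordinate:
  fixes x :: 'a
  shows "openin powerset_topology {A. x \<in> A}" "openin powerset_topology {A. x \<notin> A}"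
  using continuous_map_powerset_topology[of powerset_topology "\<lambda>A :: 'a set. A"] by simp_all

text \<open>A cylinder over a finite \<open>J\<close> is a finite intersection of clopen conditions
  on single coordinates.\<close>

lemma openin_powerset_topology_cylinder:
  assumes "finite J"
  shows "openin powerset_topology {B. B \<inter> J = A \<inter> J}"
    and "closedin powerset_topology {B. B \<inter> J = A \<inter> J}"
proof -
  have eq: "{B. B \<inter> J = A \<inter> J} = (\<Inter>x\<in>J. {B. x \<in> B \<longleftrightarrow> x \<in> A})"
    by blast
  have *: "openin powerset_topology {B. x \<in> B \<longleftrightarrow> b}" for x :: 'a and b
    by (cases b) (simp_all add: openin_powerset_topology_coordinate)
  have "closedin powerset_topology {B. x \<in> B \<longleftrightarrow> b}" for x :: 'a and b
    using *[of x "\<not> b"] by (simp add: closedin_def Collect_neg_eq[symmetric] Compl_eq_Diff_UNIV[symmetric])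
  then have "closedin powerset_topology (topspace powerset_topology \<inter> {B. B \<inter> J = A \<inter> J})"
    \<comment> \<open>The empty intersection is the whole space and is treated apart, since
      \<open>closedin_INT\<close> asks for a nonempty index set.\<close>
    unfolding eq using assms by (cases "J = {}") (use closedin_topspace[of powerset_topology] in \<open>auto intro: closedin_INT\<close>)
  moreover have "openin powerset_topology ((\<Inter>x\<in>J. {B. x \<in> B \<longleftrightarrow> x \<in> A}) \<inter> topspace powerset_topology)"
    using assms * by (rule openin_INT)
  ultimately show "openin powerset_topology {B. B \<inter> J = A \<inter> J}"
    and "closedin powerset_topology {B. B \<inter> J = A \<inter> J}"
    by (simp_all add: eq)
qed

text \<open>A basic open box of the product constrains only finitely many coordinates;
  \<open>J\<close> is the set of the constrained ones. With the previous lemma this makes the cube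
  zero-dimensional.\<close>

lemma powerset_topology_cylinder_base:
  assumes "openin powerset_topology U" "A \<in> U"
  obtains J where "finite J" "{B. B \<inter> J = A \<inter> J} \<subseteq> U"
proof -
  let ?P = "product_topology (\<lambda>_. discrete_topology UNIV) UNIV :: ('a \<Rightarrow> bool) topology"
  have "openin ?P {p \<in> topspace ?P. Collect p \<in> U}"
    using homeomorphic_maps_powerset_topology assms(1)
    by (intro openin_continuous_map_preimage[of _ powerset_topology])
      (auto simp: homeomorphic_maps_def)
  moreover have "(\<lambda>x. x \<in> A) \<in> {p \<in> topspace ?P. Collect p \<in> U}"
    using assms(2) by simp
  ultimately obtain V where fin: "finite {x. V x \<noteq> UNIV}" and AV: "\<And>x. (x \<in> A) \<in> V x"
    and sub: "Pi\<^sub>E UNIV V \<subseteq> {p. Collect p \<in> U}"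
    unfolding openin_product_topology_alt
    by (elim ballE[of _ _ "\<lambda>x. x \<in> A"]) (auto simp: PiE_iff)
  have "{B. B \<inter> {x. V x \<noteq> UNIV} = A \<inter> {x. V x \<noteq> UNIV}} \<subseteq> U"
  proof
    fix B assume "B \<in> {B. B \<inter> {x. V x \<noteq> UNIV} = A \<inter> {x. V x \<noteq> UNIV}}"
    then have "x \<in> B \<longleftrightarrow> x \<in> A" if "V x \<noteq> UNIV" for x
      using that by blast
    then have "(x \<in> B) \<in> V x" for x
      using AV[of x] by (cases "V x = UNIV") auto
    then have "(\<lambda>x. x \<in> B) \<in> Pi\<^sub>E UNIV V"
      by (simp add: PiE_iff)
    with sub show "B \<in> U"
      by auto
  qed
  with fin that show thesis
    by blast
qed

lemma homeomorphic_space_powerset_topology: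
  "(powerset_topology :: 'a set topology) homeomorphic_space
     (product_topology (\<lambda>_. discrete_topology UNIV) UNIV :: ('a \<Rightarrow> bool) topology)"
  unfolding homeomorphic_space_def by (intro exI) (rule homeomorphic_maps_powerset_topology)

lemma compact_space_powerset_topology: "compact_space powerset_topology"
  unfolding homeomorphic_compact_space[OF homeomorphic_space_powerset_topology]
  by (simp add: compact_space_product_topology compact_space_discrete_topology)

lemma Hausdorff_space_powerset_topology: "Hausdorff_space powerset_topology"
  unfolding homeomorphic_Hausdorff_space[OF homeomorphic_space_powerset_topology]
  by (simp add: Hausdorff_space_product_topology)

lemma continuous_map_sym_diff:
  assumes "continuous_map T powerset_topology f" "continuous_map T powerset_topology g"
  shows "continuous_map T powerset_topology (\<lambda>t. sym_diff (f t) (g t))"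
  unfolding continuous_map_powerset_topology
proof
  fix x
  let ?F = "\<lambda>b. {t \<in> topspace T. (x \<in> f t) = b}" and ?G = "\<lambda>b. {t \<in> topspace T. (x \<in> g t) = b}"
  have "openin T (?F b)" "openin T (?G b)" for b
    using assms by (cases b; simp add: continuous_map_powerset_topology)+
  then have "openin T (?F True \<inter> ?G False \<union> ?F False \<inter> ?G True)"
    "openin T (?F True \<inter> ?G True \<union> ?F False \<inter> ?G False)"
    by blast+
  moreover have "{t \<in> topspace T. x \<in> sym_diff (f t) (g t)} = ?F True \<inter> ?G False \<union> ?F False \<inter> ?G True"
    "{t \<in> topspace T. x \<notin> sym_diff (f t) (g t)} = ?F True \<inter> ?G True \<union> ?F False \<inter> ?G False"
    by auto
  ultimately show "openin T {t \<in> topspace T. x \<in> sym_diff (f t) (g t)} \<and>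
      openin T {t \<in> topspace T. x \<notin> sym_diff (f t) (g t)}"
    by simp
qed

lemma embedding_map_image_powerset_topology:
  assumes "inj e"
  shows "embedding_map (subtopology powerset_topology C) powerset_topology (\<lambda>A. e ` A)"
proof -
  have e: "continuous_map powerset_topology powerset_topology (\<lambda>A. e ` A)"
    unfolding continuous_map_powerset_topology
  proof
    fix y
    show "openin powerset_topology {A \<in> topspace powerset_topology. y \<in> e ` A} \<and>
        openin powerset_topology {A \<in> topspace powerset_topology. y \<notin> e ` A}"
    proof (cases "y \<in> range e")
      case True
      then show ?thesis
        using assms by (auto simp: inj_image_mem_iff openin_powerset_topology_coordinate)
    next
      case False
      then have "{A. y \<in> e ` A} = {}" "{A. y \<notin> e ` A} = topspace powerset_topology"
        by auto
      then show ?thesis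
        by (metis (no_types, lifting) UNIV_I openin_empty openin_topspace
            topspace_powerset_topology Collect_cong)
    qed
  qed
  have v: "continuous_map powerset_topology powerset_topology (\<lambda>B. e -` B)"
    by (simp add: continuous_map_powerset_topology openin_powerset_topology_coordinate)
  have "homeomorphic_maps (subtopology powerset_topology C)
      (subtopology powerset_topology ((\<lambda>A. e ` A) ` C)) (\<lambda>A. e ` A) (\<lambda>B. e -` B)"
    using assms e v
    by (auto simp: homeomorphic_maps_def continuous_map_in_subtopology
        continuous_map_from_subtopology inj_vimage_image_eq)
  then show ?thesis
    unfolding embedding_map_def homeomorphic_map_maps by auto
qed

section \<open>Groups of sets under symmetric difference\<close>

text \<open>The carrier is a parameter so that the finite sets and the full power set, which is the
  compact group around them, are instances of one construction.\<close>

definition sym_diff_group :: "'a set set \<Rightarrow> 'a set monoid" where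
  "sym_diff_group C = \<lparr> carrier = C, mult = sym_diff, one = {} \<rparr>"

lemma sym_diff_group_simps [simp]:
  "carrier (sym_diff_group C) = C"
  "A \<otimes>\<^bsub>sym_diff_group C\<^esub> B = sym_diff A B"
  "\<one>\<^bsub>sym_diff_group C\<^esub> = {}"
  by (simp_all add: sym_diff_group_def)

lemma group_sym_diff_group:
  assumes "{} \<in> C" "\<And>A B. A \<in> C \<Longrightarrow> B \<in> C \<Longrightarrow> sym_diff A B \<in> C"
  shows "group (sym_diff_group C)"
  by (rule groupI) (use assms in \<open>auto intro: bexI[of _ x for x]\<close>)

text \<open>Every element is its own inverse, so inversion is the identity map and only the
  operation needs a continuity argument.\<close>

lemma topological_group_sym_diff_group:
  assumes "{} \<in> C" "\<And>A B. A \<in> C \<Longrightarrow> B \<in> C \<Longrightarrow> sym_diff A B \<in> C"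
  shows "topological_group (sym_diff_group C) (subtopology powerset_topology C)"
proof -
  interpret group "sym_diff_group C"
    using assms by (rule group_sym_diff_group)
  have "inv\<^bsub>sym_diff_group C\<^esub> A = A" if "A \<in> C" for A
    using that by (intro inv_equality) auto
  then have "continuous_map (subtopology powerset_topology C) (subtopology powerset_topology C)
      (\<lambda>A. inv\<^bsub>sym_diff_group C\<^esub> A)"
    by (intro continuous_map_eq[OF continuous_map_id]) simp
  moreover have "continuous_map
      (prod_topology (subtopology powerset_topology C) (subtopology powerset_topology C))
      (subtopology powerset_topology C) (\<lambda>p. sym_diff (fst p) (snd p))"
    using assms(2)
    by (auto intro!: continuous_map_into_subtopology continuous_map_sym_diff
        intro: continuous_map_into_fulltopology[OF continuous_map_fst]
          continuous_map_into_fulltopology[OF continuous_map_snd])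
  ultimately show ?thesis
    by (simp add: topological_group_def group_axioms Hausdorff_space_powerset_topology
        Hausdorff_space_subtopology)
qed

text \<open>This reduces the arbitrary integer exponents in absolute productivity to their
  parity.\<close>

lemma (in group) int_pow_exponent_two:
  assumes "x \<in> carrier G" "x \<otimes> x = \<one>"
  shows "x [^] (z :: int) = (if even z then \<one> else x)"
proof -
  have even: "x [^] (2 * m) = \<one>" for m :: int
    using assms int_pow_pow[of x 2 m] int_pow_int[of G x 2]
    by (simp add: numeral_2_eq_2)
  show ?thesis
  proof (cases "even z")
    case True
    then show ?thesis
      using even by auto
  next
    case False
    then obtain m where "z = 2 * m + 1"
      by (elim oddE)
    then show ?thesis
      using assms(1) even[of m] by (simp add: int_pow_mult)
  qed
qed

section \<open>The group of finite sets: precompactness and TAP\<close>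

abbreviation finset_group :: "'a set monoid" where
  "finset_group \<equiv> sym_diff_group (Collect finite)"

abbreviation finset_topology :: "'a set topology" where
  "finset_topology \<equiv> subtopology powerset_topology (Collect finite)"

lemma topological_group_finset_group: "topological_group finset_group finset_topology"
  by (rule topological_group_sym_diff_group) auto

lemma group_finset_group: "group finset_group"
  using topological_group_finset_group topological_group_def by blast

lemma precompact_group_finset_group:
  "precompact_group (finset_group :: 'a set monoid) finset_topology"
proof -
  \<comment> \<open>The definition of precompactness fixes the type of the compact group, here
    \<open>'a set set set\<close>. The injection \<open>e\<close> moves the cube over
    \<open>'a\<close> into the cube over \<open>'a set set\<close>.\<close>
  define e :: "'a \<Rightarrow> 'a set set" where "e x = {{x}}" for x
  have e: "inj e"
    by (auto simp: e_def inj_def)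
  let ?K = "sym_diff_group UNIV :: 'a set set set monoid"
  have "topological_group ?K powerset_topology"
    using topological_group_sym_diff_group[of "UNIV :: 'a set set set set"] by simp
  moreover have "(\<lambda>A. e ` A) \<in> hom finset_group ?K"
    using e by (auto simp: hom_def image_Un image_set_diff)
  moreover have "inj_on (\<lambda>A. e ` A) (carrier finset_group)"
    using e by (simp add: inj_on_def inj_image_eq_iff)
  moreover have "embedding_map finset_topology powerset_topology (\<lambda>A. e ` A)"
    using e by (rule embedding_map_image_powerset_topology)
  ultimately show ?thesis
    unfolding precompact_group_def
    by (intro conjI exI topological_group_finset_group)
      (simp_all add: compact_space_powerset_topology)
qed

text \<open>Disjointness excludes cancellation, so the symmetric difference is a union.\<close>

lemma partial_prod_finset_group:
  assumes "\<And>n. finite (a n)" "\<And>m n. m \<noteq> n \<Longrightarrow> a m \<inter> a n = {}"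
  shows "partial_prod finset_group a (\<lambda>_. 1) k = (\<Union>n\<le>k. a n)"
proof (induction k)
  case 0
  then show ?case
    using assms(1) by (simp add: group.int_pow_1[OF group_finset_group])
next
  case (Suc k)
  have "a (Suc k) \<inter> a n = {}" if "n \<le> k" for n
    using assms(2)[of "Suc k" n] that by simp
  then have "a (Suc k) \<inter> (\<Union>n\<le>k. a n) = {}"
    by blast
  then show ?case
    using Suc assms(1)
    by (auto simp: group.int_pow_1[OF group_finset_group] atMost_Suc)
qed

text \<open>Convergence of the products of an enumeration \<open>a\<close> forces each point into
  only finitely many \<open>a n\<close>. As the sets are finite, a disjoint subsequence can be
  chosen, and its product converges to a finite \<open>l\<close> that contains all its members,
  although a finite set has only finitely many subsets.\<close>

lemma TAP_finset_group: "TAP finset_group finset_topology"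
  unfolding TAP_def
proof (intro allI impI, rule ccontr)
  fix C :: "'a set set"
  assume C: "absolutely_productive finset_group finset_topology C" and "infinite C"
  then obtain a :: "nat \<Rightarrow> 'a set" where a: "inj a" "range a \<subseteq> C"
    using infinite_countable_subset[of C] by blast
  have fin: "finite (a n)" for n
  proof -
    have "C \<subseteq> Collect finite"
      using C by (simp add: absolutely_productive_def)
    with a(2) show ?thesis
      by blast
  qed
  \<comment> \<open>Stated for any injective \<open>b\<close> with values among the
    \<open>a n\<close>, because it is applied to \<open>a\<close> itself and later to the
    subsequence \<open>a \<circ> r\<close>.\<close>
  have lim: "\<exists>l. limitin finset_topology (partial_prod finset_group b (\<lambda>_. 1)) l sequentially"
    if "inj b" "range b \<subseteq> range a" for b
  proof -
    have "inj b \<and> range b \<subseteq> C"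
      using a(2) that by blast
    then show ?thesis
      using C unfolding absolutely_productive_def by simp
  qed
  \<comment> \<open>Consecutive partial products differ exactly by \<open>a (Suc n)\<close>, and at
    \<open>x\<close> both eventually agree with the limit.\<close>
  have point: "\<forall>\<^sub>F n in sequentially. x \<notin> a n" for x
  proof -
    let ?p = "partial_prod finset_group a (\<lambda>_. 1)"
    obtain l where "limitin powerset_topology ?p l sequentially"
      using lim[of a] a(1) by (auto simp: limitin_subtopology)
    then have ev: "\<forall>\<^sub>F n in sequentially. x \<in> ?p n \<longleftrightarrow> x \<in> l"
      by (simp add: limitin_powerset_topology)
    then have "\<forall>\<^sub>F n in sequentially. x \<in> ?p (Suc n) \<longleftrightarrow> x \<in> l"
      using eventually_sequentially_Suc[of "\<lambda>n. x \<in> ?p n \<longleftrightarrow> x \<in> l"] by blast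
    with ev have "\<forall>\<^sub>F n in sequentially. x \<notin> a (Suc n)"
      by eventually_elim
        (use fin in \<open>auto simp: group.int_pow_1[OF group_finset_group]\<close>)
    then show ?thesis
      using eventually_sequentially_Suc[of "\<lambda>n. x \<notin> a n"] by blast
  qed
  \<comment> \<open>The first sets up to \<open>m\<close> have finitely many points in total, each
    eventually avoided; by injectivity at most one \<open>a n\<close> is empty.\<close>
  have "\<exists>n>m. a n \<noteq> {} \<and> (\<forall>j\<le>m. a n \<inter> a j = {})" for m
  proof -
    have "\<forall>\<^sub>F n in sequentially. \<forall>x\<in>(\<Union>j\<le>m. a j). x \<notin> a n"
      using fin point by (intro eventually_ball_finite) auto
    moreover have "\<forall>\<^sub>F n in sequentially. a n \<noteq> {}"
    proof -
      have "finite {n. a n = {}}"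
        using finite_vimageI[OF _ a(1), of "{{}}"] by (simp add: vimage_def)
      then have "\<forall>\<^sub>F n in cofinite. a n \<noteq> {}"
        unfolding eventually_cofinite by simp
      then show ?thesis
        unfolding cofinite_eq_sequentially .
    qed
    ultimately have "\<forall>\<^sub>F n in sequentially. n > m \<and> a n \<noteq> {} \<and> (\<forall>j\<le>m. a n \<inter> a j = {})"
      using eventually_gt_at_top[of m] by eventually_elim auto
    then show ?thesis
      by (rule eventually_happens'[OF sequentially_bot])
  qed
  then have "\<forall>m. \<exists>n>m. a n \<noteq> {} \<and> (\<forall>j\<le>m. a n \<inter> a j = {})"
    by blast
  then obtain s where "\<forall>m. s m > m \<and> a (s m) \<noteq> {} \<and> (\<forall>j\<le>m. a (s m) \<inter> a j = {})"
    by (rule choice[THEN exE])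
  then have s: "\<And>m. s m > m" "\<And>m. a (s m) \<noteq> {}"
      "\<And>m j. j \<le> m \<Longrightarrow> a (s m) \<inter> a j = {}"
    by simp_all
  \<comment> \<open>With \<open>Suc n\<close> iterations even \<open>r 0\<close> is a value of
    \<open>s\<close>, so that every \<open>a (r n)\<close> is nonempty.\<close>
  define r where "r n = (s ^^ Suc n) 0" for n
  have r_Suc: "r (Suc n) = s (r n)" for n
    by (simp add: r_def)
  have r: "strict_mono r"
    using s(1) by (simp add: strict_mono_Suc_iff r_Suc)
  have disj: "a (r m) \<inter> a (r n) = {}" if "m \<noteq> n" for m n
  proof -
    have "a (r n) \<inter> a (r m) = {}" if less: "m < n" for m n
    proof (cases n)
      case (Suc k)
      then have "r m \<le> r k"
        using less r by (simp add: strict_mono_less_eq)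
      then show ?thesis
        using s(3) by (simp add: Suc r_Suc)
    qed (use less in simp)
    then show ?thesis
      using that by (metis Int_commute nat_neq_iff)
  qed
  have ne: "a (r n) \<noteq> {}" for n
    using s(2) by (simp add: r_def)
  have "inj (a \<circ> r)"
    using a(1) r by (simp add: inj_compose strict_mono_imp_inj_on)
  then obtain l where "finite l"
    and l: "limitin powerset_topology (partial_prod finset_group (a \<circ> r) (\<lambda>_. 1)) l sequentially"
    using lim[of "a \<circ> r"] by (auto simp: limitin_subtopology)
  \<comment> \<open>From the index \<open>n\<close> on, the partial products are unions that include
    \<open>a (r n)\<close>, so the limit keeps its points.\<close>
  have "x \<in> l" if x: "x \<in> a (r n)" for x n
  proof -
    have "\<forall>\<^sub>F k in sequentially. x \<in> (\<Union>n\<le>k. a (r n)) \<longleftrightarrow> x \<in> l"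
      using l fin disj
      by (simp add: limitin_powerset_topology partial_prod_finset_group del: UN_iff)
    moreover have "\<forall>\<^sub>F k in sequentially. k \<ge> n"
      by (rule eventually_ge_at_top)
    ultimately have "\<forall>\<^sub>F k in sequentially. x \<in> l"
      by eventually_elim (use x in auto)
    then show ?thesis
      by simp
  qed
  then have "range (a \<circ> r) \<subseteq> Pow l"
    by auto
  then show False
    using range_inj_infinite[OF \<open>inj (a \<circ> r)\<close>] \<open>finite l\<close> finite_subset[of _ "Pow l"] by simp
qed

section \<open>Groups of continuous maps\<close>

lemma Cp_group_simps [simp]:
  "f \<otimes>\<^bsub>Cp_group S G T\<^esub> g = restrict (\<lambda>x. f x \<otimes>\<^bsub>G\<^esub> g x) (topspace S)"
  "\<one>\<^bsub>Cp_group S G T\<^esub> = restrict (\<lambda>x. \<one>\<^bsub>G\<^esub>) (topspace S)"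
  by (simp_all add: Cp_group_def)

lemma carrier_Cp_group:
  "f \<in> carrier (Cp_group S G T) \<longleftrightarrow> f \<in> extensional (topspace S) \<and> continuous_map S T f"
  by (auto simp: Cp_group_def PiE_iff continuous_map_def)

lemma restrict_in_carrier_Cp_group:
  assumes "continuous_map S T f"
  shows "restrict f (topspace S) \<in> carrier (Cp_group S G T)"
  using continuous_map_eq[OF assms, of "restrict f (topspace S)"] by (simp add: carrier_Cp_group)

text \<open>The group laws hold pointwise, and the continuity of the operations of \<open>G\<close>
  gives closure. The lemma makes \<open>int_pow_exponent_two\<close> available for groups of
  maps.\<close>

lemma group_Cp_group:
  assumes "topological_group G T"
  shows "group (Cp_group S G T)"
proof -
  interpret G: group G
    using assms by (simp add: topological_group_def)
  have top: "topspace T = carrier G"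
    using assms by (simp add: topological_group_def)
  have mem: "f x \<in> carrier G" if "f \<in> carrier (Cp_group S G T)" "x \<in> topspace S" for f x
    using that top by (auto simp: carrier_Cp_group continuous_map_def)
  show ?thesis
  proof (rule groupI)
    fix f g
    assume "f \<in> carrier (Cp_group S G T)" "g \<in> carrier (Cp_group S G T)"
    then have "continuous_map S (prod_topology T T) (\<lambda>x. (f x, g x))"
      by (simp add: carrier_Cp_group continuous_map_pairedI)
    moreover have "continuous_map (prod_topology T T) T (\<lambda>p. fst p \<otimes>\<^bsub>G\<^esub> snd p)"
      using assms by (simp add: topological_group_def)
    ultimately have "continuous_map S T ((\<lambda>p. fst p \<otimes>\<^bsub>G\<^esub> snd p) \<circ> (\<lambda>x. (f x, g x)))"
      by (rule continuous_map_compose)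
    then show "f \<otimes>\<^bsub>Cp_group S G T\<^esub> g \<in> carrier (Cp_group S G T)"
      by (simp add: restrict_in_carrier_Cp_group comp_def)
  next
    show "\<one>\<^bsub>Cp_group S G T\<^esub> \<in> carrier (Cp_group S G T)"
      by (simp add: restrict_in_carrier_Cp_group top)
  next
    fix f g h
    assume "f \<in> carrier (Cp_group S G T)" "g \<in> carrier (Cp_group S G T)"
      "h \<in> carrier (Cp_group S G T)"
    then show "f \<otimes>\<^bsub>Cp_group S G T\<^esub> g \<otimes>\<^bsub>Cp_group S G T\<^esub> h =
        f \<otimes>\<^bsub>Cp_group S G T\<^esub> (g \<otimes>\<^bsub>Cp_group S G T\<^esub> h)"
      by (auto simp: mem G.m_assoc intro: restrict_ext)
  next
    fix f
    assume f: "f \<in> carrier (Cp_group S G T)"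
    \<comment> \<open>Being extensional turns agreement on \<open>topspace S\<close> into equality
      of functions.\<close>
    then have ext: "restrict f (topspace S) = f"
      by (simp add: carrier_Cp_group extensional_restrict)
    have "restrict (\<lambda>x. \<one>\<^bsub>G\<^esub> \<otimes>\<^bsub>G\<^esub> f x) (topspace S) = restrict f (topspace S)"
      using f by (intro restrict_ext) (simp add: mem)
    then show "\<one>\<^bsub>Cp_group S G T\<^esub> \<otimes>\<^bsub>Cp_group S G T\<^esub> f = f"
      by (simp add: ext cong: restrict_cong)
    have "continuous_map S T f" "continuous_map T T (\<lambda>x. inv\<^bsub>G\<^esub> x)"
      using assms f by (simp_all add: topological_group_def carrier_Cp_group)
    then have "continuous_map S T ((\<lambda>x. inv\<^bsub>G\<^esub> x) \<circ> f)"
      by (rule continuous_map_compose)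
    then have "restrict (\<lambda>x. inv\<^bsub>G\<^esub> f x) (topspace S) \<in> carrier (Cp_group S G T)"
      by (simp add: restrict_in_carrier_Cp_group comp_def)
    moreover have "restrict (\<lambda>x. inv\<^bsub>G\<^esub> f x) (topspace S) \<otimes>\<^bsub>Cp_group S G T\<^esub> f = \<one>\<^bsub>Cp_group S G T\<^esub>"
      using f by (auto simp: mem intro!: restrict_ext)
    ultimately show "\<exists>g\<in>carrier (Cp_group S G T). g \<otimes>\<^bsub>Cp_group S G T\<^esub> f = \<one>\<^bsub>Cp_group S G T\<^esub>"
      by blast
  qed
qed

section \<open>The space of sets with at most one element\<close>

text \<open>For infinite \<open>'a\<close> this is the one-point compactification of the discrete
  space on \<open>'a\<close>, with the empty set as the point at infinity.\<close>

definition subsingleton_space :: "'a set topology" where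
  "subsingleton_space = subtopology powerset_topology {A. \<exists>i. A \<subseteq> {i}}"

lemma topspace_subsingleton_space [simp]: "topspace subsingleton_space = {A. \<exists>i. A \<subseteq> {i}}"
  by (simp add: subsingleton_space_def)

text \<open>Containing two given distinct elements is an open condition, so the complement is a
  union of open sets and the space is closed in the compact cube.\<close>

lemma compact_space_subsingleton_space: "compact_space subsingleton_space"
proof -
  have "openin powerset_topology ({A. i \<in> A} \<inter> {A :: 'a set. j \<in> A})" for i j
    by (intro openin_Int openin_powerset_topology_coordinate)
  then have "openin powerset_topology (\<Union>{{A. i \<in> A} \<inter> {A :: 'a set. j \<in> A} | i j. i \<noteq> j})"
    by (intro openin_Union) auto
  moreover have "\<Union>{{A. i \<in> A} \<inter> {A :: 'a set. j \<in> A} | i j. i \<noteq> j} = - {A. \<exists>i. A \<subseteq> {i}}"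
    (is "?L = ?R")
  proof
    show "?L \<subseteq> ?R"
      by auto
    show "?R \<subseteq> ?L"
    proof
      fix A :: "'a set" assume "A \<in> ?R"
      then have *: "\<exists>j\<in>A. j \<noteq> i" for i
        by auto
      then obtain i where "i \<in> A"
        by blast
      moreover obtain j where "j \<in> A" "j \<noteq> i"
        using * by blast
      ultimately show "A \<in> ?L"
        by blast
    qed
  qed
  ultimately have "closedin powerset_topology {A :: 'a set. \<exists>i. A \<subseteq> {i}}"
    by (simp add: closedin_def Compl_eq_Diff_UNIV)
  then show ?thesis
    unfolding subsingleton_space_def
    by (intro compact_space_subtopology closedin_compact_space compact_space_powerset_topology)
qed

lemma tychonoff_space_subsingleton_space: "tychonoff_space subsingleton_space"
proof -
  have "Hausdorff_space subsingleton_space"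
    by (simp add: subsingleton_space_def Hausdorff_space_powerset_topology
        Hausdorff_space_subtopology)
  moreover have "completely_regular_space subsingleton_space"
    by (intro locally_compact_regular_imp_completely_regular_space disjI1 calculation
        compact_imp_locally_compact_space compact_space_subsingleton_space)
  ultimately show ?thesis
    by (simp add: tychonoff_space_def)
qed

lemma countably_compact_space_if_compact_space:
  assumes "compact_space S"
  shows "countably_compact_space S"
  unfolding countably_compact_space_def
proof (intro allI impI)
  fix \<U>
  assume "countable \<U> \<and> (\<forall>U\<in>\<U>. openin S U) \<and> topspace S \<subseteq> \<Union>\<U>"
  then show "\<exists>\<F>. finite \<F> \<and> \<F> \<subseteq> \<U> \<and> topspace S \<subseteq> \<Union>\<F>"
    using assms unfolding compact_space_alt by simp
qed

text \<open>A point outside \<open>F\<close> has a clopen cylinder neighbourhood that misses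
  \<open>F\<close>; the map with value \<open>g\<close> on the cylinder and \<open>{}\<close>
  elsewhere is continuous. Any nonempty finite \<open>g\<close> works.\<close>

lemma G_star_regular_subsingleton_space:
  "G_star_regular (subsingleton_space :: 'a set topology) finset_group
     (finset_topology :: 'a set topology)"
proof -
  obtain g :: "'a set" where g: "finite g" "g \<noteq> {}"
    by (metis finite.emptyI finite_insert insert_not_empty)
  have sep: "\<exists>f \<in> carrier (Cp_group subsingleton_space finset_group finset_topology).
      f A = g \<and> f ` F \<subseteq> {{}}"
    if F: "closedin subsingleton_space F" and A: "A \<in> topspace subsingleton_space - F"
    for F and A :: "'a set"
  proof -
    have "openin subsingleton_space (topspace subsingleton_space - F)"
      using F by blast
    then obtain U where U: "openin powerset_topology U"
        "topspace subsingleton_space - F = U \<inter> topspace subsingleton_space"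
      unfolding subsingleton_space_def openin_subtopology by (metis topspace_subtopology_subset topspace_powerset_topology subset_UNIV)
    then obtain J where J: "finite J" "{B. B \<inter> J = A \<inter> J} \<subseteq> U"
      using A powerset_topology_cylinder_base[of U A] by (metis IntD1)
    let ?f = "\<lambda>B. if B \<inter> J = A \<inter> J then g else {}"
    have open1: "openin powerset_topology {B. B \<inter> J = A \<inter> J}"
      and open2: "openin powerset_topology {B. B \<inter> J \<noteq> A \<inter> J}"
      using openin_powerset_topology_cylinder[OF J(1), of A]
      by (simp_all add: closedin_def Compl_eq_Diff_UNIV[symmetric] Collect_neg_eq)
    have "continuous_map powerset_topology powerset_topology ?f"
      unfolding continuous_map_powerset_topology
    proof
      fix x
      show "openin powerset_topology {B \<in> topspace powerset_topology. x \<in> ?f B} \<and>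
          openin powerset_topology {B \<in> topspace powerset_topology. x \<notin> ?f B}"
        using open1 open2 openin_topspace[of "powerset_topology :: 'a set topology"]
        by (cases "x \<in> g") auto
    qed
    then have "continuous_map subsingleton_space finset_topology ?f"
      unfolding subsingleton_space_def
      using g(1) by (auto simp: continuous_map_in_subtopology continuous_map_from_subtopology)
    then have "restrict ?f (topspace subsingleton_space) \<in>
        carrier (Cp_group subsingleton_space finset_group finset_topology)"
      by (rule restrict_in_carrier_Cp_group)
    moreover have "restrict ?f (topspace subsingleton_space) A = g"
      using A by auto
    moreover have "restrict ?f (topspace subsingleton_space) ` F \<subseteq> {{}}"
    proof (intro image_subsetI)
      fix B assume B: "B \<in> F"
      then have "B \<in> topspace subsingleton_space"
        using closedin_subset[OF F] by blast
      with B U(2) have "B \<notin> U"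
        by blast
      with J(2) have "B \<inter> J \<noteq> A \<inter> J"
        by blast
      with \<open>B \<in> topspace subsingleton_space\<close>
      show "restrict ?f (topspace subsingleton_space) B \<in> {{}}"
        by (simp del: topspace_subsingleton_space)
    qed
    ultimately show ?thesis
      by blast
  qed
  show ?thesis
    unfolding G_star_regular_def sym_diff_group_simps
  proof (intro bexI[of _ g] conjI allI impI)
    show "g \<noteq> {}" "g \<in> Collect finite"
      using g by simp_all
  qed (use sep in blast)
qed

text \<open>The set \<open>J\<close> may be infinite: the values stay finite because the points of
  the space have at most one element. This keeps the limits of infinite products inside the group of
  maps.\<close>

lemma trace_in_Cp_group:
  "restrict (\<lambda>x. x \<inter> J) (topspace subsingleton_space) \<in>
     carrier (Cp_group subsingleton_space finset_group finset_topology)"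
proof -
  have "continuous_map powerset_topology powerset_topology (\<lambda>x. x \<inter> J)"
    unfolding continuous_map_powerset_topology
  proof
    fix y
    show "openin powerset_topology {x \<in> topspace powerset_topology. y \<in> x \<inter> J} \<and>
        openin powerset_topology {x \<in> topspace powerset_topology. y \<notin> x \<inter> J}"
      using openin_powerset_topology_coordinate[of y]
        openin_topspace[of "powerset_topology :: 'a set topology"]
      by (cases "y \<in> J") auto
  qed
  then have "continuous_map subsingleton_space finset_topology (\<lambda>x. x \<inter> J)"
    unfolding subsingleton_space_def
    by (auto simp: continuous_map_in_subtopology continuous_map_from_subtopology
        intro: finite_subset)
  then show ?thesis
    by (rule restrict_in_carrier_Cp_group)
qed

text \<open>The map \<open>t\<close> turns symmetric differences of arbitrary subsets of
  \<open>'a\<close> into products of continuous maps. Products of distinct singletons converge in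
  the cube, in general to infinite sets, and \<open>t\<close> carries this convergence over
  pointwise.\<close>

lemma not_TAP_Cp_subsingleton_space:
  assumes "infinite (UNIV :: 'a set)"
  shows "\<not> TAP (Cp_group (subsingleton_space :: 'a set topology) finset_group
      (finset_topology :: 'a set topology)) (Cp_topology subsingleton_space finset_group finset_topology)"
proof -
  let ?X = "topspace (subsingleton_space :: 'a set topology)"
  let ?C = "Cp_group (subsingleton_space :: 'a set topology) finset_group
      (finset_topology :: 'a set topology)"
  interpret group ?C
    by (rule group_Cp_group[OF topological_group_finset_group])
  define t where "t J = restrict (\<lambda>x :: 'a set. x \<inter> J) ?X" for J
  have t: "t J \<in> carrier ?C" for J
    unfolding t_def by (rule trace_in_Cp_group)
  have pow: "t J [^]\<^bsub>?C\<^esub> z = t (if even z then {} else J)" for J and z :: int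
  proof -
    have "t J \<otimes>\<^bsub>?C\<^esub> t J = \<one>\<^bsub>?C\<^esub>" "t {} = \<one>\<^bsub>?C\<^esub>"
      by (auto simp: t_def intro: restrict_ext)
    with t show ?thesis
      by (simp add: int_pow_exponent_two del: Cp_group_simps)
  qed
  have mult: "t I \<otimes>\<^bsub>?C\<^esub> t J = t (sym_diff I J)" for I J
    unfolding t_def Cp_group_simps by (rule restrict_ext) auto
  have "infinite (range (\<lambda>i. t {i}))"
  proof -
    \<comment> \<open>Evaluation at the point \<open>{i}\<close> separates the maps.\<close>
    have "t {i} {i} \<noteq> t {j} {i}" if "i \<noteq> j" for i j
      using that by (auto simp: t_def)
    then have "inj (\<lambda>i. t {i})"
      unfolding inj_def by metis
    then show ?thesis
      using assms finite_imageD by blast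
  qed
  moreover have "absolutely_productive ?C
      (Cp_topology subsingleton_space finset_group finset_topology) (range (\<lambda>i. t {i}))"
    unfolding absolutely_productive_def
  proof (intro conjI allI impI)
    show "range (\<lambda>i. t {i}) \<subseteq> carrier ?C"
      using t by blast
  next
    fix a :: "nat \<Rightarrow> 'a set \<Rightarrow> 'a set" and z :: "nat \<Rightarrow> int"
    assume a: "inj a \<and> range a \<subseteq> range (\<lambda>i. t {i})"
    then have "\<forall>n. \<exists>i. a n = t {i}"
      by blast
    then obtain c where c: "\<And>n. a n = t {c n}"
      by metis
    have inj: "inj c"
      using a c by (metis injD injI)
    \<comment> \<open>Only factors with odd exponent survive, and since \<open>c\<close> is
      injective they never cancel.\<close>
    define L where "L k = c ` {n. n \<le> k \<and> odd (z n)}" for k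
    have pp: "partial_prod ?C a z k = t (L k)" for k
    proof (induction k)
      case 0
      have "(if even (z 0) then {} else {c 0}) = L 0"
        by (auto simp: L_def intro!: Nat.gr0I)
      then show ?case
        by (simp only: partial_prod.simps c[of 0] pow)
    next
      case (Suc k)
      have "c (Suc k) \<notin> L k"
        using inj by (auto simp: L_def inj_eq)
      moreover have "{n. n \<le> Suc k \<and> odd (z n)} =
          (if even (z (Suc k)) then {} else {Suc k}) \<union> {n. n \<le> k \<and> odd (z n)}"
        by (auto simp: le_Suc_eq)
      then have "L (Suc k) = (if even (z (Suc k)) then {} else {c (Suc k)}) \<union> L k"
        by (simp add: L_def image_Un)
      ultimately have "sym_diff (L k) (if even (z (Suc k)) then {} else {c (Suc k)}) = L (Suc k)"
        by auto
      then show ?case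
        by (simp only: partial_prod.simps Suc c[of "Suc k"] pow mult)
    qed
    \<comment> \<open>The union of the increasing sets \<open>L k\<close>, hence their
      coordinatewise limit.\<close>
    define M where "M = c ` {n. odd (z n)}"
    have ev: "\<forall>\<^sub>F k in sequentially. y \<in> L k \<longleftrightarrow> y \<in> M" for y
    proof (cases "y \<in> M")
      case True
      then obtain n where n: "y = c n" "odd (z n)"
        by (auto simp: M_def)
      have "\<forall>\<^sub>F k in sequentially. k \<ge> n"
        by (rule eventually_ge_at_top)
      then show ?thesis
        by eventually_elim (use n True in \<open>auto simp: L_def\<close>)
    next
      case False
      then have "y \<notin> L k" for k
        by (auto simp: L_def M_def)
      with False show ?thesis
        by simp
    qed
    have "limitin powerset_topology (\<lambda>k. x \<inter> L k) (x \<inter> M) sequentially" for x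
      unfolding limitin_powerset_topology
    proof
      fix y
      show "\<forall>\<^sub>F k in sequentially. y \<in> x \<inter> L k \<longleftrightarrow> y \<in> x \<inter> M"
        using ev[of y] by eventually_elim auto
    qed
    moreover have "finite x" if "x \<in> ?X" for x
      using that by (auto intro: finite_subset)
    ultimately have "limitin finset_topology (\<lambda>k. t (L k) x) (t M x) sequentially" if "x \<in> ?X" for x
      using that by (simp add: limitin_subtopology t_def)
    moreover have "t J \<in> topspace (product_topology (\<lambda>_. finset_topology) ?X)" for J
      using t[of J] by (simp add: Cp_group_def)
    ultimately have "limitin (Cp_topology subsingleton_space finset_group finset_topology)
        (\<lambda>k. t (L k)) (t M) sequentially"
      unfolding Cp_topology_def limitin_subtopology limitin_componentwise
      using t by (simp add: t_def)
    moreover have "partial_prod ?C a z = (\<lambda>k. t (L k))"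
      by (rule ext) (rule pp)
    ultimately show "\<exists>l. limitin (Cp_topology subsingleton_space finset_group finset_topology)
        (partial_prod ?C a z) l sequentially"
      by auto
  qed
  ultimately show ?thesis
    unfolding TAP_def by blast
qed

theorem theorem6p8:
  shows "\<exists>(G :: real set set monoid) (TG :: real set set topology)
            (S :: real set set topology).
     precompact_group G TG \<and> TAP G TG \<and>
     topspace S \<noteq> {} \<and> tychonoff_space S \<and>
     countably_compact_space S \<and> G_star_regular S G TG \<and>
     \<not> TAP (Cp_group S G TG) (Cp_topology S G TG)"
proof -
  \<comment> \<open>The types in the statement make \<open>real set\<close> the index type, so that
    group elements and points of the space both have type \<open>real set set\<close>.\<close>
  have "infinite (UNIV :: real set set)"
    by (simp add: Finite_Set.finite_set infinite_UNIV_char_0)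
  moreover have "topspace (subsingleton_space :: real set set topology) \<noteq> {}"
    by auto
  ultimately show ?thesis
    using precompact_group_finset_group TAP_finset_group tychonoff_space_subsingleton_space
      countably_compact_space_if_compact_space[OF compact_space_subsingleton_space]
      G_star_regular_subsingleton_space not_TAP_Cp_subsingleton_space
    by blast
qed

end
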